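(* Consider the FlexPD-G iterates described in the context with $\alpha,\beta>0$ and integer $T\ge1$. For any $\bar d,\bar c,\bar g,\bar e>1$ and every $k\ge0$, \[\|\lambda^{k+1}-\lambda^*\|^2\le\frac{\bar d\bar c}{\alpha^2 s(AA')}\Big(\bar g+\frac{\bar g\alpha^2L^2}{\bar g-1}\Big)\|x^{k+1,T}-x^{k+1,T-1}\|^2+\frac{\bar d\bar c}{s(AA')(\bar c-1)}\Big(\bar e\beta^2\rho^2(A'A)+\frac{\bar eL^2}{\bar e-1}\Big)\|x^{k+1,T}-x^*\|^2+\frac{\bar d\rho^2(B)}{s(AA')(\bar d-1)}\|x^k-x^*\|^2.\]
   Context: Setting: $n$ agents are connected by a connected undirected graph with edge set $\mathcal E$, $\epsilon=|\mathcal E|$. For $x\in\mathbb R^n$ let $f(x)=\sum_{i=1}^n f_i(x_i)$, where each $f_i:\mathbb R\to\mathbb R$ is twice differentiable with $m\le f_i''\le L$ for constants $0<m\le L$; $\nabla f(x)=(f_1'(x_1),\dots,f_n'(x_n))'$. $A\in\mathbb R^{\epsilon\times n}$ is the edge–node incidence matrix (null space spanned by the all-ones vector). $B\in\mathbb R^{n\times n}$ is symmetric positive semidefinite with the same null space as $A$, off-diagonal entries nonzero only on edges, and $\rho(B)<m$. $x^*$ is the unique minimizer of $f$ subject to $Ax=0$ and $\lambda^*$ a Lagrange multiplier with $\nabla f(x^* )+A'\lambda^*=0$, $Ax^*=0$, $Bx^*=0$, chosen in the column space of $A$ (orthogonal to the null space of $A'$). FlexPD-G: given $\alpha,\beta>0$,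 $T\ge1$, $x^0$ arbitrary, $\lambda^0=0$; for $k\ge0$: $x^{k+1,0}=x^k$; for $t=1,\dots,T$, $x^{k+1,t}=x^{k+1,t-1}-\alpha\nabla f(x^{k+1,t-1})-\alpha A'\lambda^k-\alpha Bx^k$; then $x^{k+1}=x^{k+1,T}$, $\lambda^{k+1}=\lambda^k+\beta Ax^{k+1}$. Notation: $\rho(S)$ largest eigenvalue of symmetric $S$; $s(AA')$ smallest nonzero eigenvalue of $AA'$; $\|\cdot\|$ Euclidean norm. *)

theory Defs
  imports "HOL-Analysis.Analysis"
begin

text \<open>Real eigenvalues of a square real matrix.\<close>
definition eigvals :: "real^'n^'n \<Rightarrow> real set" where
  "eigvals S = {\<mu>. \<exists>v. v \<noteq> 0 \<and> S *v v = \<mu> *\<^sub>R v}"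

text \<open>rho S: largest eigenvalue of the symmetric matrix S.\<close>
definition rho :: "real^'n^'n \<Rightarrow> real" where
  "rho S = Max (eigvals S)"

text \<open>s S: smallest nonzero eigenvalue of the symmetric matrix S.\<close>
definition smin_nz :: "real^'n^'n \<Rightarrow> real" where
  "smin_nz S = Min (eigvals S - {0})"

text \<open>Graph given by an edge-endpoint map; adjacency.\<close>
definition adj :: "('e \<Rightarrow> 'n \<times> 'n) \<Rightarrow> 'n \<Rightarrow> 'n \<Rightarrow> bool" where
  "adj ends i j \<longleftrightarrow> (\<exists>e. ends e = (i, j) \<or> ends e = (j, i))"

text \<open>Simple connected undirected graph whose edges are indexed by type 'e,
  each edge given an (arbitrary) orientation ends e = (head, tail).\<close>
definition simple_connected_graph :: "('e::finite \<Rightarrow> 'n::finite \<times> 'n) \<Rightarrow> bool" where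
  "simple_connected_graph ends \<longleftrightarrow>
     (\<forall>e. fst (ends e) \<noteq> snd (ends e)) \<and>
     (\<forall>e e'. ends e = ends e' \<or> ends e = prod.swap (ends e') \<longrightarrow> e = e') \<and>
     (\<forall>i j. (adj ends)\<^sup>*\<^sup>* i j)"

text \<open>Edge-node incidence matrix.\<close>
definition incidence :: "('e \<Rightarrow> 'n \<times> 'n) \<Rightarrow> real^'n^'e" where
  "incidence ends = (\<chi> e i. if i = fst (ends e) then 1 else if i = snd (ends e) then -1 else 0)"

text \<open>Separable objective and its gradient.\<close>
definition fsum :: "('n::finite \<Rightarrow> real \<Rightarrow> real) \<Rightarrow> real^'n \<Rightarrow> real" where
  "fsum f x = (\<Sum>i\<in>UNIV. f i (x $ i))"

definition grad :: "('n::finite \<Rightarrow> real \<Rightarrow> real) \<Rightarrow> real^'n \<Rightarrow> real^'n" where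
  "grad f' x = (\<chi> i. f' i (x $ i))"

end

theory Submission
  imports Defs
begin

text \<open>
  Write \<open>y = x^{k+1,T}\<close> and \<open>z = x^{k+1,T-1}\<close>. The last inner step and the KKT conditions
  \<open>\<nabla>f(x*) + A'\<lambda>* = 0\<close>, \<open>Ax* = 0\<close>, \<open>Bx* = 0\<close> give
  \<open>A'(\<lambda>^{k+1} - \<lambda>*) = [(z - y)/\<alpha> - (\<nabla>f(z) - \<nabla>f(y))] + [\<beta>A'A(y - x*) - (\<nabla>f(y) - \<nabla>f(x*))] - B(x^k - x*)\<close>.
  The multipliers stay in the column space of \<open>A\<close>, on which \<open>s(AA')|v|^2 \<le> |A'v|^2\<close>; the bound
  then follows from three applications of \<open>|u + v|^2 \<le> c|u|^2 + c/(c - 1)|v|^2\<close>, the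
  \<open>L\<close>-Lipschitz gradient and \<open>|Mv| \<le> \<rho>(M)|v|\<close> for symmetric positive semidefinite \<open>M\<close>.

  Both spectral facts come from showing that an extremal value of \<open>|Mv|\<close> on the unit sphere
  (resp. of \<open>|A'v|\<close> on the unit sphere of the column space of \<open>A\<close>) is an eigenvalue: at the
  extremal vector the quadratic form of a positive semidefinite self-adjoint map vanishes,
  so the vector lies in its kernel.
\<close>

section \<open>Extremal eigenvalues of symmetric matrices\<close>

lemma linear_coeff_zero_if_quadratic_nonneg:
  fixes a b :: real
  assumes nonneg: "\<And>t. 0 \<le> 2 * t * a + t\<^sup>2 * b"
  shows "a = 0"
proof (rule ccontr)
  assume "a \<noteq> 0"
  define c where "c = \<bar>b\<bar> + 1"
  have c_pos: "0 < c" unfolding c_def by simp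
  have "0 \<le> (2 * (- a / c) * a + (- a / c)\<^sup>2 * b) * c\<^sup>2"
    using nonneg[of "- a / c"] by simp
  also have "\<dots> = a\<^sup>2 * (b - 2 * c)"
    using c_pos by (simp add: field_simps power2_eq_square)
  also have "\<dots> < 0"
    using \<open>a \<noteq> 0\<close> unfolding c_def by (intro mult_pos_neg) (auto simp: abs_if)
  finally show False by simp
qed

lemma self_adjoint_apply_zero_if_form_zero:
  fixes h :: "'a::real_inner \<Rightarrow> 'a"
  assumes lin: "linear h" and adj: "\<And>u w. inner u (h w) = inner (h u) w"
    and V: "subspace V" and nonneg: "\<And>u. u \<in> V \<Longrightarrow> 0 \<le> inner u (h u)"
    and v: "v \<in> V" and hv: "h v \<in> V" and form_zero: "inner v (h v) = 0"
  shows "h v = 0"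
proof -
  have "0 \<le> 2 * t * inner (h v) (h v) + t\<^sup>2 * inner (h v) (h (h v))" for t
  proof -
    have "v + t *\<^sub>R h v \<in> V" using V v hv by (simp add: subspace_add subspace_scale)
    hence "0 \<le> inner (v + t *\<^sub>R h v) (h (v + t *\<^sub>R h v))" by (rule nonneg)
    also have "\<dots> = 2 * t * inner (h v) (h v) + t\<^sup>2 * inner (h v) (h (h v))"
      using form_zero adj[of v "h v"]
      by (simp add: linear_add[OF lin] linear_scale[OF lin] inner_add_left inner_add_right
          inner_commute power2_eq_square algebra_simps)
    finally show ?thesis .
  qed
  hence "inner (h v) (h v) = 0" by (rule linear_coeff_zero_if_quadratic_nonneg)
  thus ?thesis by simp
qed

lemma inner_matrix_vector_mult_transpose:
  fixes A :: "real^'n^'m"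
  shows "inner u (A *v w) = inner (transpose A *v u) w"
  by (metis dot_lmul_matrix transpose_matrix_vector)

lemma finite_eigvals:
  fixes M :: "real^'n^'n"
  assumes sym: "transpose M = M"
  shows "finite (eigvals M)"
proof -
  define vec where "vec \<mu> = (SOME v. v \<noteq> 0 \<and> M *v v = \<mu> *\<^sub>R v)" for \<mu>
  have vec: "vec \<mu> \<noteq> 0 \<and> M *v vec \<mu> = \<mu> *\<^sub>R vec \<mu>" if "\<mu> \<in> eigvals M" for \<mu>
    using that unfolding eigvals_def vec_def by (metis (mono_tags, lifting) mem_Collect_eq someI_ex)
  have inj: "inj_on vec (eigvals M)"
  proof
    fix a b assume a: "a \<in> eigvals M" and b: "b \<in> eigvals M" and eq: "vec a = vec b"
    have "a *\<^sub>R vec a = b *\<^sub>R vec a" using vec[OF a] vec[OF b] eq by metis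
    thus "a = b" using vec[OF a] by simp
  qed
  have "pairwise orthogonal (vec ` eigvals M)"
  proof (rule pairwiseI, clarify)
    fix a b assume a: "a \<in> eigvals M" and b: "b \<in> eigvals M" and "vec a \<noteq> vec b"
    hence "a \<noteq> b" by auto
    have "a * inner (vec a) (vec b) = inner (M *v vec a) (vec b)" using vec[OF a] by simp
    also have "\<dots> = inner (vec a) (M *v vec b)"
      using inner_matrix_vector_mult_transpose[of "vec a" M] sym by simp
    also have "\<dots> = b * inner (vec a) (vec b)" using vec[OF b] by simp
    finally show "orthogonal (vec a) (vec b)"
      using \<open>a \<noteq> b\<close> unfolding orthogonal_def by (metis mult_cancel_right)
  qed
  moreover have "0 \<notin> vec ` eigvals M" using vec by auto
  ultimately have "finite (vec ` eigvals M)"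
    using pairwise_orthogonal_independent finiteI_independent by blast
  thus ?thesis using inj finite_imageD by blast
qed

lemma unit_vector_maximizing_norm:
  fixes f :: "'a::euclidean_space \<Rightarrow> 'b::real_normed_vector"
  assumes lin: "linear f"
  obtains v where "norm v = 1" "\<And>u. norm (f u) \<le> norm (f v) * norm u"
proof -
  have "continuous_on (sphere 0 1) (\<lambda>u. norm (f u))"
    using lin by (intro continuous_intros linear_continuous_on) (simp add: linear_conv_bounded_linear)
  then obtain v where v: "v \<in> sphere 0 1" and max: "\<And>u. u \<in> sphere 0 1 \<Longrightarrow> norm (f u) \<le> norm (f v)"
    using continuous_attains_sup[of "sphere (0::'a) 1"] by fastforce
  have "norm (f u) \<le> norm (f v) * norm u" for u
  proof (cases "u = 0")
    case False
    hence "norm (f (u /\<^sub>R norm u)) \<le> norm (f v)" by (intro max) simp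
    thus ?thesis using False by (simp add: linear_scale[OF lin] field_simps)
  qed (simp add: linear_0[OF lin])
  with v show ?thesis using that by simp
qed

lemma unit_vector_minimizing_norm_on_subspace:
  fixes f :: "'a::euclidean_space \<Rightarrow> 'b::real_normed_vector"
  assumes lin: "linear f" and V: "subspace V" and nontrivial: "V \<noteq> {0}"
  obtains v where "v \<in> V" "norm v = 1" "\<And>u. u \<in> V \<Longrightarrow> norm (f v) * norm u \<le> norm (f u)"
proof -
  let ?S = "sphere 0 1 \<inter> V"
  obtain w where "w \<in> V" "w \<noteq> 0" using nontrivial V subspace_0 by blast
  hence "w /\<^sub>R norm w \<in> ?S" using V by (simp add: subspace_scale)
  moreover have "compact ?S" using V by (intro compact_Int_closed closed_subspace) simp_all
  moreover have "continuous_on ?S (\<lambda>u. norm (f u))"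
    using lin by (intro continuous_intros linear_continuous_on) (simp add: linear_conv_bounded_linear)
  ultimately obtain v where v: "v \<in> ?S" and min: "\<And>u. u \<in> ?S \<Longrightarrow> norm (f v) \<le> norm (f u)"
    using continuous_attains_inf[of ?S] by blast
  have "norm (f v) * norm u \<le> norm (f u)" if "u \<in> V" for u
  proof (cases "u = 0")
    case False
    hence "norm (f v) \<le> norm (f (u /\<^sub>R norm u))" using that V by (intro min) (simp add: subspace_scale)
    thus ?thesis using False by (simp add: linear_scale[OF lin] field_simps)
  qed simp
  moreover have "v \<in> V" "norm v = 1" using v by simp_all
  ultimately show ?thesis using that by blast
qed

lemma norm_maximizer_in_eigvals:
  fixes M :: "real^'n^'n"
  assumes sym: "transpose M = M" and psd: "\<And>u. 0 \<le> inner u (M *v u)"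
    and unit: "norm v = 1" and max: "\<And>u. norm (M *v u) \<le> norm (M *v v) * norm u"
  shows "norm (M *v v) \<in> eigvals M"
proof -
  define \<mu> where "\<mu> = norm (M *v v)"
  have M_adj: "inner u (M *v w) = inner (M *v u) w" for u w
    using inner_matrix_vector_mult_transpose[of u M w] sym by simp
  define h where "h u = \<mu>\<^sup>2 *\<^sub>R u - M *v (M *v u)" for u
  have form: "inner u (h u) = \<mu>\<^sup>2 * (norm u)\<^sup>2 - (norm (M *v u))\<^sup>2" for u
    unfolding h_def using M_adj[of u "M *v u"] by (simp add: inner_diff_right power2_norm_eq_inner)
  have "h v = 0"
  proof (rule self_adjoint_apply_zero_if_form_zero[of h UNIV v])
    show "linear h" unfolding h_def linear_iff by (simp add: algebra_simps)
    show "inner u (h w) = inner (h u) w" for u w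
      unfolding h_def using M_adj by (simp add: inner_diff_left inner_diff_right)
    show "0 \<le> inner u (h u)" for u
      using max[of u] unfolding form \<mu>_def by (simp add: power_mono power_mult_distrib[symmetric])
    show "inner v (h v) = 0" unfolding form \<mu>_def using unit by simp
  qed simp_all
  hence MM: "M *v (M *v v) = \<mu>\<^sup>2 *\<^sub>R v" unfolding h_def by simp
  show ?thesis
  proof (cases "M *v v + \<mu> *\<^sub>R v = 0")
    case False
    have "M *v (M *v v + \<mu> *\<^sub>R v) = \<mu> *\<^sub>R (M *v v + \<mu> *\<^sub>R v)"
      using MM by (simp add: algebra_simps power2_eq_square)
    with False show ?thesis unfolding eigvals_def \<mu>_def by blast
  next
    case True
    \<comment> \<open>then \<open>-\<mu>\<close> is an eigenvalue, which positive semidefiniteness forces to be \<open>0\<close>\<close>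
    hence Mv: "M *v v = - \<mu> *\<^sub>R v" by (simp add: eq_neg_iff_add_eq_0)
    have "0 \<le> inner v (M *v v)" by (rule psd)
    also have "\<dots> = - \<mu>" using unit Mv by (simp add: power2_norm_eq_inner[symmetric])
    finally have "\<mu> = 0" unfolding \<mu>_def by simp
    hence "v \<noteq> 0 \<and> M *v v = \<mu> *\<^sub>R v" using Mv unit by auto
    thus ?thesis unfolding eigvals_def \<mu>_def by blast
  qed
qed

lemma norm_matrix_vector_le_rho:
  fixes M :: "real^'n^'n"
  assumes sym: "transpose M = M" and psd: "\<And>u. 0 \<le> inner u (M *v u)"
  shows "(norm (M *v v))\<^sup>2 \<le> (rho M)\<^sup>2 * (norm v)\<^sup>2"
proof -
  obtain w where unit: "norm w = 1" and max: "\<And>u. norm (M *v u) \<le> norm (M *v w) * norm u"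
    using unit_vector_maximizing_norm[OF matrix_vector_mul_linear] by blast
  have "norm (M *v w) \<le> rho M"
    unfolding rho_def using finite_eigvals[OF sym] norm_maximizer_in_eigvals[OF sym psd unit max]
    by simp
  hence "norm (M *v v) \<le> rho M * norm v"
    using max[of v] by (meson mult_right_mono norm_ge_zero order_trans)
  hence "(norm (M *v v))\<^sup>2 \<le> (rho M * norm v)\<^sup>2" by (simp add: power_mono)
  thus ?thesis by (simp add: power_mult_distrib)
qed

lemma transpose_norm_minimizer_in_eigvals:
  fixes A :: "real^'n^'m"
  assumes v: "v \<in> range ((*v) A)" and unit: "norm v = 1"
    and min: "\<And>u. u \<in> range ((*v) A) \<Longrightarrow> norm (transpose A *v v) * norm u \<le> norm (transpose A *v u)"
  shows "(norm (transpose A *v v))\<^sup>2 \<in> eigvals (A ** transpose A)"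
proof -
  define \<mu> where "\<mu> = (norm (transpose A *v v))\<^sup>2"
  define h where "h u = A *v (transpose A *v u) - \<mu> *\<^sub>R u" for u
  have AAt_adj: "inner u (A *v (transpose A *v w)) = inner (A *v (transpose A *v u)) w" for u w
    by (metis inner_matrix_vector_mult_transpose inner_commute)
  have form: "inner u (h u) = (norm (transpose A *v u))\<^sup>2 - \<mu> * (norm u)\<^sup>2" for u
    unfolding h_def using inner_matrix_vector_mult_transpose[of u A "transpose A *v u"]
    by (simp add: inner_diff_right power2_norm_eq_inner del: transpose_matrix_vector)
  have "h v = 0"
  proof (rule self_adjoint_apply_zero_if_form_zero[of h "range ((*v) A)" v])
    show "linear h"
      unfolding h_def linear_iff
      by (simp add: matrix_vector_right_distrib matrix_vector_mult_scaleR algebra_simps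
          del: transpose_matrix_vector)
    show "inner u (h w) = inner (h u) w" for u w
      unfolding h_def using AAt_adj by (simp add: inner_diff_left inner_diff_right)
    show "0 \<le> inner u (h u)" if "u \<in> range ((*v) A)" for u
      using min[OF that] unfolding form \<mu>_def
      by (simp add: power_mono power_mult_distrib[symmetric])
    show "subspace (range ((*v) A))"
      by (intro linear_subspace_image subspace_UNIV) simp
    obtain y where y: "v = A *v y" using v by blast
    have "h v = A *v (transpose A *v v - \<mu> *\<^sub>R y)"
      unfolding h_def y by (simp add: matrix_vector_mult_diff_distrib matrix_vector_mult_scaleR
          del: transpose_matrix_vector)
    thus "h v \<in> range ((*v) A)" by simp
    show "inner v (h v) = 0" unfolding form \<mu>_def using unit by simp
  qed (fact v)
  hence "v \<noteq> 0 \<and> (A ** transpose A) *v v = \<mu> *\<^sub>R v"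
    using unit unfolding h_def
    by (auto simp: matrix_vector_mul_assoc[symmetric] simp del: transpose_matrix_vector)
  thus ?thesis unfolding eigvals_def \<mu>_def by blast
qed

lemma inner_transpose_mult_self_nonneg:
  fixes A :: "real^'n^'m"
  shows "0 \<le> inner v ((transpose A ** A) *v v)"
  using inner_matrix_vector_mult_transpose[of "A *v v" A v]
  by (metis inner_commute inner_ge_zero matrix_vector_mul_assoc)

lemma eigvals_mult_transpose_nonneg:
  fixes A :: "real^'n^'m"
  assumes "\<mu> \<in> eigvals (A ** transpose A)"
  shows "0 \<le> \<mu>"
proof -
  obtain u where u: "u \<noteq> 0" "(A ** transpose A) *v u = \<mu> *\<^sub>R u"
    using assms unfolding eigvals_def by blast
  have "\<mu> * inner u u = inner u (A *v (transpose A *v u))"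
    using u(2) by (simp add: matrix_vector_mul_assoc del: transpose_matrix_vector)
  also have "\<dots> = (norm (transpose A *v u))\<^sup>2"
    using inner_matrix_vector_mult_transpose[of u A "transpose A *v u"]
    by (simp add: power2_norm_eq_inner del: transpose_matrix_vector)
  finally have "0 \<le> \<mu> * inner u u" by simp
  moreover have "0 < inner u u" using u(1) by simp
  ultimately show ?thesis by (simp add: zero_le_mult_iff)
qed

lemma smin_nz_mult_transpose:
  fixes A :: "real^'n^'m"
  assumes "A \<noteq> 0"
  shows smin_nz_mult_transpose_pos: "0 < smin_nz (A ** transpose A)"
    and smin_nz_mult_transpose_le:
      "v \<in> range ((*v) A) \<Longrightarrow> smin_nz (A ** transpose A) * (norm v)\<^sup>2 \<le> (norm (transpose A *v v))\<^sup>2"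
proof -
  have "range ((*v) A) \<noteq> {0}"
    using assms matrix_eq[of A 0] by auto
  then obtain w where w: "w \<in> range ((*v) A)" and unit: "norm w = 1"
    and min: "\<And>u. u \<in> range ((*v) A) \<Longrightarrow> norm (transpose A *v w) * norm u \<le> norm (transpose A *v u)"
    using unit_vector_minimizing_norm_on_subspace[OF matrix_vector_mul_linear, of "range ((*v) A)"]
    by (metis linear_subspace_image matrix_vector_mul_linear subspace_UNIV)
  define \<mu> where "\<mu> = (norm (transpose A *v w))\<^sup>2"
  define E where "E = eigvals (A ** transpose A) - {0}"
  have "\<mu> \<noteq> 0"
  proof
    assume "\<mu> = 0"
    obtain y where "w = A *v y" using w by blast
    hence "inner w w = inner (transpose A *v w) y"
      using inner_matrix_vector_mult_transpose[of w A y] by simp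
    thus False using \<open>\<mu> = 0\<close> unit unfolding \<mu>_def by simp
  qed
  hence \<mu>_in: "\<mu> \<in> E"
    unfolding E_def \<mu>_def using transpose_norm_minimizer_in_eigvals[OF w unit min] by simp
  have finE: "finite E"
    unfolding E_def by (simp add: finite_eigvals matrix_transpose_mul)
  hence "Min E \<in> E" using \<mu>_in by (intro Min_in) auto
  thus "0 < smin_nz (A ** transpose A)"
    unfolding smin_nz_def E_def[symmetric] using eigvals_mult_transpose_nonneg[of "Min E" A]
    by (force simp: E_def)
  assume "v \<in> range ((*v) A)"
  have "Min E * (norm v)\<^sup>2 \<le> \<mu> * (norm v)\<^sup>2"
    using finE \<mu>_in by (simp add: mult_right_mono)
  also have "\<dots> \<le> (norm (transpose A *v v))\<^sup>2"
    using min[OF \<open>v \<in> range ((*v) A)\<close>] unfolding \<mu>_def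
    by (simp add: power_mono power_mult_distrib[symmetric])
  finally show "smin_nz (A ** transpose A) * (norm v)\<^sup>2 \<le> (norm (transpose A *v v))\<^sup>2"
    unfolding smin_nz_def E_def .
qed

section \<open>Weighted triangle inequality and Lipschitz gradients\<close>

lemma norm_add_squared_le:
  fixes u v :: "'a::real_normed_vector"
  assumes c: "1 < c"
  shows "(norm (u + v))\<^sup>2 \<le> c * (norm u)\<^sup>2 + c / (c - 1) * (norm v)\<^sup>2"
proof -
  have "(norm (u + v))\<^sup>2 \<le> (norm u + norm v)\<^sup>2"
    by (simp add: norm_triangle_ineq power_mono)
  also have "\<dots> \<le> c * (norm u)\<^sup>2 + c / (c - 1) * (norm v)\<^sup>2"
  proof -
    have "0 \<le> ((c - 1) * norm u - norm v)\<^sup>2 / (c - 1)" using c by simp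
    thus ?thesis using c by (simp add: field_simps power2_eq_square)
  qed
  finally show ?thesis .
qed

lemma norm_diff_squared_le_of_bounds:
  fixes u v :: "'a::real_normed_vector"
  assumes c: "1 < c" and u: "(norm u)\<^sup>2 \<le> a * N" and v: "(norm v)\<^sup>2 \<le> b * N"
  shows "(norm (u - v))\<^sup>2 \<le> (c * a + c * b / (c - 1)) * N"
proof -
  have "(norm (u - v))\<^sup>2 \<le> c * (norm u)\<^sup>2 + c / (c - 1) * (norm v)\<^sup>2"
    using norm_add_squared_le[OF c, of u "- v"] by simp
  also have "\<dots> \<le> c * (a * N) + c / (c - 1) * (b * N)"
    using c u v by (intro add_mono mult_left_mono) auto
  finally show ?thesis by (simp add: algebra_simps)
qed

lemma norm_add_diff_squared_le:
  fixes Q R W :: "'a::real_normed_vector"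
  assumes d: "1 < d" and c: "1 < c"
    and Q: "(norm Q)\<^sup>2 \<le> q" and R: "(norm R)\<^sup>2 \<le> r" and W: "(norm W)\<^sup>2 \<le> w"
  shows "(norm (Q + R - W))\<^sup>2 \<le> d * c * q + d * c / (c - 1) * r + d / (d - 1) * w"
proof -
  have "(norm (Q + R))\<^sup>2 \<le> c * q + c * r / (c - 1)"
    using norm_diff_squared_le_of_bounds[OF c, of Q q 1 "- R" r] Q R by simp
  hence "(norm ((Q + R) - W))\<^sup>2 \<le> (d * (c * q + c * r / (c - 1)) + d * w / (d - 1)) * 1"
    using W by (intro norm_diff_squared_le_of_bounds[OF d]) simp_all
  thus ?thesis by (simp add: algebra_simps)
qed

lemma abs_diff_le_of_deriv_bound:
  fixes g g' :: "real \<Rightarrow> real"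
  assumes deriv: "\<And>t. (g has_real_derivative g' t) (at t)" and bound: "\<And>t. \<bar>g' t\<bar> \<le> L"
  shows "\<bar>g s - g t\<bar> \<le> L * \<bar>s - t\<bar>"
proof -
  have "norm (g s - g t) \<le> L * norm (s - t)"
  proof (rule differentiable_bound[of UNIV])
    fix x :: real
    show "(g has_derivative (*) (g' x)) (at x within UNIV)"
      using deriv by (simp add: has_field_derivative_def)
    show "onorm ((*) (g' x)) \<le> L"
      by (rule onorm_le) (simp add: abs_mult mult_right_mono bound)
  qed auto
  thus ?thesis by simp
qed

lemma norm_grad_diff_squared_le:
  fixes f' f'' :: "'n::finite \<Rightarrow> real \<Rightarrow> real"
  assumes deriv: "\<And>i t. (f' i has_real_derivative f'' i t) (at t)"
    and bound: "\<And>i t. \<bar>f'' i t\<bar> \<le> L"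
  shows "(norm (grad f' a - grad f' b))\<^sup>2 \<le> L\<^sup>2 * (norm (a - b))\<^sup>2"
proof -
  have "(f' i (a $ i) - f' i (b $ i))\<^sup>2 \<le> L\<^sup>2 * (a $ i - b $ i)\<^sup>2" for i
  proof -
    have "\<bar>f' i (a $ i) - f' i (b $ i)\<bar> \<le> L * \<bar>a $ i - b $ i\<bar>"
      by (rule abs_diff_le_of_deriv_bound[OF deriv bound])
    hence "\<bar>f' i (a $ i) - f' i (b $ i)\<bar>\<^sup>2 \<le> (L * \<bar>a $ i - b $ i\<bar>)\<^sup>2"
      by (intro power_mono) auto
    thus ?thesis by (simp add: power_mult_distrib)
  qed
  hence "(\<Sum>i\<in>UNIV. (f' i (a $ i) - f' i (b $ i))\<^sup>2) \<le> (\<Sum>i\<in>UNIV. L\<^sup>2 * (a $ i - b $ i)\<^sup>2)"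
    by (intro sum_mono)
  thus ?thesis
    unfolding power2_norm_eq_inner inner_vec_def grad_def
    by (simp add: sum_distrib_left power2_eq_square)
qed

section \<open>The dual error of FlexPD-G\<close>

lemma incidence_nonzero: "incidence ends \<noteq> 0"
proof
  assume "incidence ends = 0"
  moreover have "incidence ends $ e $ fst (ends e) = 1" for e unfolding incidence_def by simp
  ultimately show False by simp
qed

lemma dual_residual_identity:
  fixes At :: "'e::real_vector \<Rightarrow> 'n::real_vector"
  assumes At: "linear At" and A: "linear A" and B: "linear B" and \<alpha>: "\<alpha> \<noteq> 0"
    and step: "y = z - \<alpha> *\<^sub>R g z - \<alpha> *\<^sub>R At lam - \<alpha> *\<^sub>R B x"
    and KKT: "g xstar + At lamstar = 0" and A_xstar: "A xstar = 0" and B_xstar: "B xstar = 0"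
  shows "At (lam + \<beta> *\<^sub>R A y - lamstar) =
      ((1 / \<alpha>) *\<^sub>R (z - y) - (g z - g y))
      + (\<beta> *\<^sub>R At (A (y - xstar)) - (g y - g xstar))
      - B (x - xstar)"
proof -
  have "\<alpha> *\<^sub>R At lam = \<alpha> *\<^sub>R ((1 / \<alpha>) *\<^sub>R (z - y) - g z - B x)"
    using step \<alpha> by (simp add: algebra_simps)
  hence "At lam = (1 / \<alpha>) *\<^sub>R (z - y) - g z - B x" using \<alpha> by simp
  moreover have "At lamstar = - g xstar" using KKT by (simp add: eq_neg_iff_add_eq_0 add.commute)
  ultimately show ?thesis
    using A_xstar B_xstar
    by (simp add: linear_add[OF At] linear_diff[OF At] linear_scale[OF At]
        linear_diff[OF A] linear_diff[OF B] algebra_simps)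
qed

lemma dual_iterates_in_range:
  assumes A: "linear A" and lam0: "lam 0 = 0"
    and lam_step: "\<And>k. lam (Suc k) = lam k + \<beta> *\<^sub>R A (x (Suc k))"
  shows "lam k \<in> range A"
proof (induction k)
  case 0 show ?case using lam0 linear_0[OF A] by (metis rangeI)
next
  case (Suc k)
  then obtain u where "lam k = A u" by blast
  hence "lam (Suc k) = A (u + \<beta> *\<^sub>R x (Suc k))"
    using lam_step by (simp add: linear_add[OF A] linear_scale[OF A])
  thus ?case by simp
qed

lemma norm_step_residual_squared_le:
  fixes g :: "'a::real_normed_vector \<Rightarrow> 'a"
  assumes c: "1 < c" and \<alpha>: "0 < \<alpha>"
    and lip: "(norm (g z - g y))\<^sup>2 \<le> L\<^sup>2 * (norm (z - y))\<^sup>2"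
  shows "(norm ((1 / \<alpha>) *\<^sub>R (z - y) - (g z - g y)))\<^sup>2
    \<le> (c + c * \<alpha>\<^sup>2 * L\<^sup>2 / (c - 1)) * ((norm (z - y))\<^sup>2 / \<alpha>\<^sup>2)"
  (is "?lhs \<le> _")
proof -
  have "(norm ((1 / \<alpha>) *\<^sub>R (z - y)))\<^sup>2 \<le> 1 * ((norm (z - y))\<^sup>2 / \<alpha>\<^sup>2)"
    by (simp add: power_divide)
  moreover have "(norm (g z - g y))\<^sup>2 \<le> (\<alpha>\<^sup>2 * L\<^sup>2) * ((norm (z - y))\<^sup>2 / \<alpha>\<^sup>2)"
    using lip \<alpha> by simp
  ultimately have "?lhs \<le> (c * 1 + c * (\<alpha>\<^sup>2 * L\<^sup>2) / (c - 1)) * ((norm (z - y))\<^sup>2 / \<alpha>\<^sup>2)"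
    by (rule norm_diff_squared_le_of_bounds[OF c])
  thus ?thesis by (simp add: mult.assoc)
qed

lemma norm_scaled_matrix_residual_squared_le:
  fixes M :: "real^'n^'n"
  assumes c: "1 < c" and sym: "transpose M = M" and psd: "\<And>u. 0 \<le> inner u (M *v u)"
    and lip: "(norm w)\<^sup>2 \<le> L\<^sup>2 * (norm v)\<^sup>2"
  shows "(norm (\<beta> *\<^sub>R (M *v v) - w))\<^sup>2 \<le> (c * \<beta>\<^sup>2 * (rho M)\<^sup>2 + c * L\<^sup>2 / (c - 1)) * (norm v)\<^sup>2"
  (is "?lhs \<le> _")
proof -
  have "(norm (\<beta> *\<^sub>R (M *v v)))\<^sup>2 \<le> (\<beta>\<^sup>2 * (rho M)\<^sup>2) * (norm v)\<^sup>2"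
    using norm_matrix_vector_le_rho[OF sym psd, of v]
    by (simp add: power_mult_distrib mult.assoc mult_left_mono)
  with lip have "?lhs \<le> (c * (\<beta>\<^sup>2 * (rho M)\<^sup>2) + c * L\<^sup>2 / (c - 1)) * (norm v)\<^sup>2"
    by (intro norm_diff_squared_le_of_bounds[OF c])
  thus ?thesis by (simp add: mult.assoc)
qed

theorem lemma3p11:
  fixes ends :: "'e::finite \<Rightarrow> 'n::finite \<times> 'n"
    and A :: "real^'n^'e" and B :: "real^'n^'n"
    and f f' f'' :: "'n \<Rightarrow> real \<Rightarrow> real"
    and m L \<alpha> \<beta> :: real and T :: nat
    and xstar :: "real^'n" and lamstar :: "real^'e"
    and xs :: "nat \<Rightarrow> nat \<Rightarrow> real^'n" and x :: "nat \<Rightarrow> real^'n"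
    and lam :: "nat \<Rightarrow> real^'e"
    and dbar cbar gbar ebar :: real and k :: nat
  assumes graph: "simple_connected_graph ends"
    and A_def: "A = incidence ends"
    and f_deriv: "\<And>i t. (f i has_real_derivative f' i t) (at t)"
    and f'_deriv: "\<And>i t. (f' i has_real_derivative f'' i t) (at t)"
    and m_pos: "0 < m" and mL: "m \<le> L"
    and f''_bounds: "\<And>i t. m \<le> f'' i t \<and> f'' i t \<le> L"
    and B_sym: "transpose B = B"
    and B_psd: "\<And>v. 0 \<le> v \<bullet> (B *v v)"
    and B_null: "\<And>v. B *v v = 0 \<longleftrightarrow> A *v v = 0"
    and B_sparse: "\<And>i j. i \<noteq> j \<Longrightarrow> B $ i $ j \<noteq> 0 \<Longrightarrow> adj ends i j"
    and B_rho: "rho B < m"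
    and xstar_feas: "A *v xstar = 0"
    and xstar_min: "\<And>y. A *v y = 0 \<Longrightarrow> fsum f xstar \<le> fsum f y"
    and xstar_unique: "\<And>y. A *v y = 0 \<Longrightarrow> fsum f y \<le> fsum f xstar \<Longrightarrow> y = xstar"
    and KKT: "grad f' xstar + transpose A *v lamstar = 0"
    and Bxstar: "B *v xstar = 0"
    and lamstar_range: "lamstar \<in> range (\<lambda>y. A *v y)"
    and \<alpha>_pos: "0 < \<alpha>" and \<beta>_pos: "0 < \<beta>" and T_pos: "1 \<le> T"
    and lam0: "lam 0 = 0"
    and inner0: "\<And>k. xs (Suc k) 0 = x k"
    and inner_step: "\<And>k t. 1 \<le> t \<Longrightarrow> t \<le> T \<Longrightarrow>
        xs (Suc k) t = xs (Suc k) (t - 1) - \<alpha> *\<^sub>R grad f' (xs (Suc k) (t - 1))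
                       - \<alpha> *\<^sub>R (transpose A *v lam k) - \<alpha> *\<^sub>R (B *v x k)"
    and x_step: "\<And>k. x (Suc k) = xs (Suc k) T"
    and lam_step: "\<And>k. lam (Suc k) = lam k + \<beta> *\<^sub>R (A *v x (Suc k))"
    and dbar: "1 < dbar" and cbar: "1 < cbar" and gbar: "1 < gbar" and ebar: "1 < ebar"
  shows "(norm (lam (Suc k) - lamstar))\<^sup>2 \<le>
      dbar * cbar / (\<alpha>\<^sup>2 * smin_nz (A ** transpose A))
        * (gbar + gbar * \<alpha>\<^sup>2 * L\<^sup>2 / (gbar - 1))
        * (norm (xs (Suc k) T - xs (Suc k) (T - 1)))\<^sup>2
    + dbar * cbar / (smin_nz (A ** transpose A) * (cbar - 1))
        * (ebar * \<beta>\<^sup>2 * (rho (transpose A ** A))\<^sup>2 + ebar * L\<^sup>2 / (ebar - 1))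
        * (norm (xs (Suc k) T - xstar))\<^sup>2
    + dbar * (rho B)\<^sup>2 / (smin_nz (A ** transpose A) * (dbar - 1))
        * (norm (x k - xstar))\<^sup>2"
proof -
  define y z where "y = xs (Suc k) T" and "z = xs (Suc k) (T - 1)"
  define D where "D = lam (Suc k) - lamstar"
  have A_nz: "A \<noteq> 0" unfolding A_def by (rule incidence_nonzero)
  have s_pos: "0 < smin_nz (A ** transpose A)" by (rule smin_nz_mult_transpose_pos[OF A_nz])
  have "\<bar>f'' i t\<bar> \<le> L" for i t using f''_bounds[of i t] m_pos by linarith
  hence Lip: "(norm (grad f' a - grad f' b))\<^sup>2 \<le> L\<^sup>2 * (norm (a - b))\<^sup>2" for a b
    by (rule norm_grad_diff_squared_le[OF f'_deriv])
  have AtD: "transpose A *v D =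
      ((1 / \<alpha>) *\<^sub>R (z - y) - (grad f' z - grad f' y))
      + (\<beta> *\<^sub>R ((transpose A ** A) *v (y - xstar)) - (grad f' y - grad f' xstar))
      - B *v (x k - xstar)"
    unfolding D_def lam_step x_step y_def[symmetric] matrix_vector_mul_assoc[symmetric]
    using inner_step[of T k] T_pos \<alpha>_pos KKT xstar_feas Bxstar unfolding y_def z_def
    by (intro dual_residual_identity[OF matrix_vector_mul_linear matrix_vector_mul_linear
          matrix_vector_mul_linear]) auto
  have D_range: "D \<in> range ((*v) A)"
    unfolding D_def using dual_iterates_in_range[of "(*v) A", OF _ lam0 lam_step] lamstar_range
    by (intro subspace_diff linear_subspace_image subspace_UNIV) auto
  note Q = norm_step_residual_squared_le[OF gbar \<alpha>_pos Lip[of z y], unfolded norm_minus_commute[of z]]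
  have AtA_sym: "transpose (transpose A ** A) = transpose A ** A"
    by (simp add: matrix_transpose_mul)
  note R = norm_scaled_matrix_residual_squared_le[where \<beta> = \<beta>,
      OF ebar AtA_sym inner_transpose_mult_self_nonneg Lip[of y xstar]]
  note W = norm_matrix_vector_le_rho[OF B_sym B_psd, of "x k - xstar"]
  have "(norm D)\<^sup>2 \<le> (norm (transpose A *v D))\<^sup>2 / smin_nz (A ** transpose A)"
    using smin_nz_mult_transpose_le[OF A_nz D_range] s_pos by (simp add: pos_le_divide_eq mult.commute)
  also note divide_right_mono[OF norm_add_diff_squared_le[OF dbar cbar Q R W, folded AtD]
      less_imp_le[OF s_pos]]
  finally show ?thesis
    unfolding D_def
    by (rule ord_le_eq_trans)
      (simp add: add_divide_distrib y_def z_def mult_ac)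
qed

end
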